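(* Let $(\sigma_{n,s})_{n,s\ge0}$ be the array determined by $\sigma_{0,0}=1$, $\sigma_{0,s}=(2s-1)!!$ for $s\ge1$, and, for $n\ge1$ and $s\ge0$, $$\sigma_{n,s}=\sum_{k=1}^n\left(\sigma_{k-1,1}\,\sigma_{n-k,s}+\sigma_{k-1,0}\,\sigma_{n-k,s+1}\right).$$ Then the generating function $F(z,w):=\sum_{n,s\ge0}\sigma_{n,s}z^n\frac{w^s}{s!}$ satisfies the partial differential equation $$F(z,w)=(1-2w)^{-1/2}+z\left(\frac{\partial F(z,0)}{\partial w}F(z,w)+F(z,0)\frac{\partial F(z,w)}{\partial w}\right).$$
   Context: $F$ is a generating function (formal power series in $z$ and $w$). The notation $\frac{\partial F(z,0)}{\partial w}$ means $\frac{\partial F}{\partial w}$ evaluated at $w=0$. *)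

theory Defs
  imports "HOL-Computational_Algebra.Formal_Power_Series"
begin

fun double_fact :: "nat \<Rightarrow> nat" where
  "double_fact 0 = 1"
| "double_fact (Suc 0) = 1"
| "double_fact (Suc (Suc n)) = Suc (Suc n) * double_fact n"

function sigma :: "nat \<Rightarrow> nat \<Rightarrow> nat" where
  "sigma n s =
     (if n = 0 then (if s = 0 then 1 else double_fact (2 * s - 1))
      else \<Sum>k = 1..n. (sigma (k - 1) 1 * sigma (n - k) s
                         + sigma (k - 1) 0 * sigma (n - k) (s + 1)))"
  by pat_completeness auto
termination
  by (relation "measure fst") auto

declare sigma.simps [simp del]

text \<open>Power series in z and w are series in z whose coefficients are series in w:
  the coefficient of z^n w^s in G is fps_nth (fps_nth G n) s, the variable z is fps_X, and a series in w
  alone is embedded by fps_const.\<close>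

definition gen_F :: "'a::field_char_0 fps fps" where
  "gen_F = Abs_fps (\<lambda>n. Abs_fps (\<lambda>s. of_nat (sigma n s) / fact s))"

definition partial_w :: "'a::field_char_0 fps fps \<Rightarrow> 'a fps fps" where
  "partial_w G = Abs_fps (\<lambda>n. fps_deriv (fps_nth G n))"

definition at_w_0 :: "'a::field_char_0 fps fps \<Rightarrow> 'a fps fps" where
  "at_w_0 G = Abs_fps (\<lambda>n. fps_const (fps_nth (fps_nth G n) 0))"

text \<open>(1 - 2w)^(-1/2), as the binomial series (1 + X)^(-1/2) at X = -2w.\<close>

definition inv_sqrt_1_minus_2w :: "'a::field_char_0 fps" where
  "inv_sqrt_1_minus_2w = fps_compose (fps_binomial (- 1 / 2)) (fps_const (- 2) * fps_X)"

end

theory Submission imports Defs begin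

text \<open>The identity is checked coefficientwise in \<open>z\<close>.  At \<open>z\<^sup>0\<close> it says that \<open>(1 - 2w)\<^bsup>-1/2\<^esup>\<close> is the
  exponential generating function of the double factorials \<open>(2s - 1)!!\<close>
  (\<open>inv_sqrt_1_minus_2w_nth\<close>), which is the initial condition of the array.  At
  \<open>z\<^bsup>n+1\<^esup>\<close> the two Cauchy products in \<open>z\<close> reproduce the recurrence: setting \<open>w = 0\<close> in
  \<open>F\<close> and in its \<open>w\<close>-derivative leaves the constants \<open>\<sigma>\<^bsub>i,0\<^esub>\<close> and \<open>\<sigma>\<^bsub>i,1\<^esub>\<close>, and
  differentiating an exponential generating function shifts \<open>s\<close> to \<open>s + 1\<close>.\<close>

text \<open>At \<open>s = 0\<close> the subtraction on naturals truncates, so that \<open>2 * s - 1 = 0\<close> and the double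
  factorial takes the conventional value \<open>(-1)!! = 1\<close>; the formula, like the initial condition of
  the array, therefore needs no case distinction.\<close>

lemma double_fact_odd_eq_gbinomial:
  "(of_nat (double_fact (2 * s - 1)) :: 'a::field_char_0)
     = fact s * (- 2) ^ s * ((- 1 / 2) gchoose s)"
proof (induction s)
  case 0
  then show ?case by simp
next
  case (Suc s)
  have "double_fact (2 * Suc s - 1) = (2 * s + 1) * double_fact (2 * s - 1)"
    by (cases s) auto
  hence "(of_nat (double_fact (2 * Suc s - 1)) :: 'a)
      = (2 * of_nat s + 1) * (fact s * (- 2) ^ s * ((- 1 / 2) gchoose s))"
    by (simp only: of_nat_mult of_nat_add of_nat_numeral of_nat_1 Suc.IH)
  also have "\<dots> = fact s * (- 2) ^ Suc s * (((- 1 / 2) - of_nat s) * ((- 1 / 2) gchoose s))"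
    by (simp add: field_simps)
  also have "((- 1 / 2) - of_nat s) * ((- 1 / 2) gchoose s)
      = of_nat (Suc s) * ((- 1 / 2 :: 'a) gchoose Suc s)"
    by (simp only: gbinomial_mult_1 algebra_simps)
  also have "fact s * (- 2) ^ Suc s * (of_nat (Suc s) * ((- 1 / 2 :: 'a) gchoose Suc s))
      = fact (Suc s) * (- 2) ^ Suc s * ((- 1 / 2) gchoose Suc s)"
    by (simp add: algebra_simps)
  finally show ?case .
qed

lemma inv_sqrt_1_minus_2w_nth:
  "fps_nth (inv_sqrt_1_minus_2w :: 'a::field_char_0 fps) s
     = of_nat (double_fact (2 * s - 1)) / fact s"
  by (simp add: inv_sqrt_1_minus_2w_def fps_compose_linear double_fact_odd_eq_gbinomial
      del: One_nat_def)

lemma sigma_0: "sigma 0 s = double_fact (2 * s - 1)"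
  by (simp add: sigma.simps)

lemma sigma_Suc:
  "sigma (Suc n) s = (\<Sum>i=0..n. sigma i 1 * sigma (n - i) s + sigma i 0 * sigma (n - i) (s + 1))"
proof -
  have "sigma (Suc n) s = (\<Sum>k=Suc 0..Suc n. sigma (k - 1) 1 * sigma (Suc n - k) s
      + sigma (k - 1) 0 * sigma (Suc n - k) (s + 1))"
    by (subst sigma.simps) simp
  then show ?thesis
    by (simp only: sum.shift_bounds_cl_Suc_ivl diff_Suc_1 diff_Suc_Suc)
qed

lemma gen_F_nth: "fps_nth (fps_nth gen_F n) s = of_nat (sigma n s) / fact s"
  by (simp add: gen_F_def)

lemma partial_w_gen_F_nth:
  "fps_nth (fps_nth (partial_w gen_F) n) s = of_nat (sigma n (s + 1)) / fact s"
  by (simp add: partial_w_def gen_F_nth del: of_nat_Suc)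

lemma at_w_0_mult_nth:
  "fps_nth (fps_nth (at_w_0 G * H) n) s
     = (\<Sum>i=0..n. fps_nth (fps_nth G i) 0 * fps_nth (fps_nth H (n - i)) s)"
  by (simp add: at_w_0_def fps_mult_nth [of _ H] fps_sum_nth)

theorem corollary1p14:
  shows "(gen_F :: 'a::field_char_0 fps fps) =
    fps_const inv_sqrt_1_minus_2w
    + fps_X * (at_w_0 (partial_w gen_F) * gen_F + at_w_0 gen_F * partial_w gen_F)"
    (is "_ = ?rhs")
proof (intro fps_ext)
  fix n s
  show "fps_nth (fps_nth gen_F n) s = fps_nth (fps_nth ?rhs n) s"
  proof (cases n)
    case 0
    then show ?thesis
      by (simp add: gen_F_nth sigma_0 inv_sqrt_1_minus_2w_nth)
  next
    case (Suc m)
    have "fps_nth (fps_nth ?rhs n) s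
        = (\<Sum>i=0..m. of_nat (sigma i 1) * (of_nat (sigma (m - i) s) / fact s))
          + (\<Sum>i=0..m. of_nat (sigma i 0) * (of_nat (sigma (m - i) (s + 1)) / fact s))"
      by (simp add: Suc at_w_0_mult_nth gen_F_nth partial_w_gen_F_nth)
    also have "\<dots> = of_nat (sigma n s) / fact s"
      by (simp add: Suc sigma_Suc sum.distrib sum_divide_distrib add_divide_distrib)
    finally show ?thesis by (simp add: gen_F_nth)
  qed
qed

end
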